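(* Let $r_j(\mathbf{u})=\left\|\frac{d^j}{dw^j}\nabla^2 f(\mathbf{x}^*+w\mathbf{u})\big|_{w=0}\right\|_2$ and let $\epsilon>0$ be a constant that satisfies the necessary condition $\epsilon<\inf_{\|\mathbf{u}\|=1}\left(\limsup_{j\to\infty}\sqrt[j]{\frac{r_j(\mathbf{u})}{j!}}\right)^{-1}$. Then for any $\mathbf{x}_k\in\mathcal{B}_\epsilon(\mathbf{x}^* )$ such that $\mathbf{x}_k=\mathbf{x}^*+p\,\mathbf{u}_k$ with $0<p\le1$, the Hessian $\nabla^2 f(\mathbf{x}_k)$ is given by $$\nabla^2 f(\mathbf{x}_k)=\nabla^2 f(\mathbf{x}^* )+p\,\|\mathbf{u}_k\|\,\mathbf{H}(\hat{\mathbf{u}}_k)+\mathcal{O}(\epsilon^2),$$ where $\hat{\mathbf{u}}_k=\frac{\mathbf{u}_k}{\|\mathbf{u}_k\|}$ and $$\mathbf{H}(\hat{\mathbf{u}}_k)=\sum_{i=1}^n\Big(\langle\mathbf{v}_i(0),\mathbf{H}(\hat{\mathbf{u}}_k)\mathbf{v}_i(0)\rangle\,\mathbf{v}_i(0)\mathbf{v}_i(0)^T+\lambda_i(0)\Big(\sum_{l\ne i}\frac{\langle\mathbf{v}_l(0),\mathbf{H}(\hat{\mathbf{u}}_k)\mathbf{v}_i(0)\rangle}{\lambda_i(0)-\lambda_l(0)}\mathbf{v}_l(0)\Big)\mathbf{v}_i(0)^T+\lambda_i(0)\mathbf{v}_i(0)\Big(\sum_{l\ne i}\frac{\langle\mathbf{v}_l(0),\mathbf{H}(\hat{\mathbf{u}}_k)\mathbf{v}_i(0)\rangle}{\lambda_i(0)-\lambda_l(0)}\mathbf{v}_l(0)\Big)^T\Big)$$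 with $\lambda_i(0),\mathbf{v}_i(0)$ being the $i$-th eigenvalue–eigenvector pair of $\nabla^2 f(\mathbf{x}^* )$.
   Context: Assumptions on $f:\mathbb{R}^n\to\mathbb{R}$: (i) $f$ is globally $\mathcal{C}^2$ and real analytic in sufficiently large neighborhoods of its saddle points; (ii) $\|\nabla f(\mathbf{x})-\nabla f(\mathbf{y})\|\le L\|\mathbf{x}-\mathbf{y}\|$; (iii) $\|\nabla^2 f(\mathbf{x})-\nabla^2 f(\mathbf{y})\|_2\le M\|\mathbf{x}-\mathbf{y}\|$; (iv) at every critical point of $f$, all eigenvalues of the Hessian have absolute value $>\beta$, where $\beta>0$. $\mathbf{x}^*$ is a strict saddle point of $f$ ($\nabla f(\mathbf{x}^* )=\mathbf{0}$; the Hessian has at least one negative eigenvalue). The eigenvectors $\mathbf{v}_i(0)$ of $\nabla^2 f(\mathbf{x}^* )$ are orthonormal and its eigenvalues are non-degenerate, with $|\lambda_i(0)-\lambda_l(0)|\ge\delta>0$ for $i\ne l$. $\mathcal{B}_\epsilon(\mathbf{x}^* )$ is the open ball of (small) radius $\epsilon$ about $\mathbf{x}^*$, and $\mathbf{u}_k\neq\mathbf{0}$ is a radial vector based at $\mathbf{x}^*$ with $\|\mathbf{u}_k\|\le\epsilon$. For a unit vector $\hat{\mathbf{u}}$, $\mathbf{H}(\hat{\mathbf{u}})=\frac{d}{dw}\nabla^2 f(\mathbf{x}^*+w\hat{\mathbf{u}})\big|_{w=0}$. Matrix-valued $\mathcal{O}(\epsilon^2)$ terms are measured in the Frobenius norm.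 *)

theory Defs
  imports "HOL-Analysis.Analysis"
begin

definition grad :: "(real^'n \<Rightarrow> real) \<Rightarrow> real^'n \<Rightarrow> real^'n" where
  "grad f x = (THE D. GDERIV f x :> D)"

definition hess :: "(real^'n \<Rightarrow> real) \<Rightarrow> real^'n \<Rightarrow> real^'n^'n" where
  "hess f x = jacobian (grad f) (at x)"

(* grad and hess are meaningful only at points of differentiability, so this is required separately. *)
definition C2 :: "(real^'n \<Rightarrow> real) \<Rightarrow> bool" where
  "C2 f \<longleftrightarrow> (\<forall>x. f differentiable (at x)) \<and> (\<forall>x. grad f differentiable (at x)) \<and>
     continuous_on UNIV (hess f)"

(* Around every point of U, f is the sum of an (absolutely) convergent power series in the
   coordinates; a :: 'n => nat is the multi-index. *)
definition real_analytic_on :: "(real^'n \<Rightarrow> real) \<Rightarrow> (real^'n) set \<Rightarrow> bool" where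
  "real_analytic_on f U \<longleftrightarrow>
     (\<forall>y\<in>U. \<exists>(c :: ('n \<Rightarrow> nat) \<Rightarrow> real) e. e > 0 \<and>
        (\<forall>x\<in>ball y e. ((\<lambda>a. c a * (\<Prod>i\<in>UNIV. (x $ i - y $ i) ^ a i)) has_sum f x) UNIV))"

definition eigenpair :: "real^'n^'n \<Rightarrow> real \<Rightarrow> real^'n \<Rightarrow> bool" where
  "eigenpair A \<mu> v \<longleftrightarrow> v \<noteq> 0 \<and> A *v v = \<mu> *\<^sub>R v"

definition eigenval :: "real^'n^'n \<Rightarrow> real \<Rightarrow> bool" where
  "eigenval A \<mu> \<longleftrightarrow> (\<exists>v. eigenpair A \<mu> v)"

definition critical_point :: "(real^'n \<Rightarrow> real) \<Rightarrow> real^'n \<Rightarrow> bool" where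
  "critical_point f x \<longleftrightarrow> grad f x = 0"

definition strict_saddle :: "(real^'n \<Rightarrow> real) \<Rightarrow> real^'n \<Rightarrow> bool" where
  "strict_saddle f x \<longleftrightarrow> critical_point f x \<and> (\<exists>\<mu><0. eigenval (hess f x) \<mu>)"

(* The matrix 2-norm. The library's norm on the type real^'n^'n is the Frobenius norm. *)
definition spectral_norm :: "real^'n^'n \<Rightarrow> real" where
  "spectral_norm A = onorm ((*v) A)"

definition outer :: "real^'n \<Rightarrow> real^'n \<Rightarrow> real^'n^'n" where
  "outer x y = (\<chi> i j. x $ i * y $ j)"

(* The j-th derivative at w = 0 of w \<mapsto> hess f (x + w u). *)
definition hess_dderiv :: "(real^'n \<Rightarrow> real) \<Rightarrow> real^'n \<Rightarrow> nat \<Rightarrow> real^'n \<Rightarrow> real^'n^'n" where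
  "hess_dderiv f x j u =
     ((\<lambda>g w. vector_derivative g (at w)) ^^ j) (\<lambda>w::real. hess f (x + w *\<^sub>R u)) 0"

end

(* Near a saddle point, f is a convergent power series, which may be differentiated term by term;
   so each entry of the Hessian is again a power series, and the Hessian is its value at xs plus a
   linear map B with symmetric values plus a remainder bounded by K |z|^2 for |z| <= rho. For
   |z| > rho, where the series says nothing, the Lipschitz bound on the Hessian makes the remainder
   at most D |z| <= (D / rho) |z|^2, so one constant serves every epsilon. The formula for H holds
   for every symmetric matrix S: its (l, i) entry in the eigenbasis receives from the two
   eigenvector terms lam_i S_li / (lam_i - lam_l) and lam_l S_il / (lam_l - lam_i), which sum to
   S_li. *)
theory Submission
  imports Defs
begin

section \<open>Power series in several variables\<close>

definition mpow :: "real^'n \<Rightarrow> ('n \<Rightarrow> nat) \<Rightarrow> real" where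
  "mpow z a = (\<Prod>i\<in>UNIV. z $ i ^ a i)"

definition mdeg :: "('n::finite \<Rightarrow> nat) \<Rightarrow> nat" where
  "mdeg a = (\<Sum>i\<in>UNIV. a i)"

definition psum :: "(('n \<Rightarrow> nat) \<Rightarrow> real) \<Rightarrow> real^'n \<Rightarrow> real" where
  "psum c z = (\<Sum>\<^sub>\<infinity>a. c a * mpow z a)"

text \<open>The strict bound \<open>\<sigma> < \<rho>\<close> always leaves a slightly larger
  admissible radius, which absorbs the polynomial factors created by differentiation. So
  \<open>\<rho>\<close> survives any number of derivatives.\<close>

definition converges_within :: "(('n::finite \<Rightarrow> nat) \<Rightarrow> real) \<Rightarrow> real \<Rightarrow> bool" where
  "converges_within c \<rho> \<longleftrightarrow>
     (\<forall>\<sigma>. 0 < \<sigma> \<longrightarrow> \<sigma> < \<rho> \<longrightarrow> (\<lambda>a. \<bar>c a\<bar> * \<sigma> ^ mdeg a) summable_on UNIV)"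

text \<open>Coefficients of the formal derivative in the i-th variable: the monomial with exponents
  \<open>a\<close> arises from the one whose i-th exponent is larger by one.\<close>

definition partial_coeff :: "'n \<Rightarrow> (('n \<Rightarrow> nat) \<Rightarrow> real) \<Rightarrow> ('n \<Rightarrow> nat) \<Rightarrow> real" where
  "partial_coeff i c a = real (Suc (a i)) * c (a(i := Suc (a i)))"

text \<open>Equality of mixed partial derivatives at the level of coefficients; it makes the linear
  part of the Hessian symmetric.\<close>

lemma partial_coeff_commute: "partial_coeff i (partial_coeff j c) = partial_coeff j (partial_coeff i c)"
  by (cases "i = j") (auto simp: fun_eq_iff partial_coeff_def fun_upd_twist)

lemma mdeg_remove: "mdeg a = a i + (\<Sum>j\<in>UNIV - {i}. a j)"
  by (simp add: mdeg_def sum.remove)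

lemma mpow_remove: "mpow z a = z $ i ^ a i * (\<Prod>j\<in>UNIV - {i}. z $ j ^ a j)"
  by (simp add: mpow_def prod.remove)

lemma le_mdeg: "a i \<le> mdeg a"
  by (simp add: mdeg_remove[of a i])

text \<open>An arbitrary index set \<open>S\<close> covers both a whole monomial and a monomial with
  one coordinate split off.\<close>

lemma abs_mpow_remove_le:
  fixes z :: "real^'n"
  assumes "\<And>j. \<bar>z $ j\<bar> \<le> \<sigma>"
  shows "\<bar>\<Prod>j\<in>S. z $ j ^ a j\<bar> \<le> \<sigma> ^ (\<Sum>j\<in>S. a j)"
  unfolding abs_prod power_sum by (intro prod_mono) (auto simp: power_abs intro!: power_mono assms)

lemma abs_mpow_le:
  assumes "norm z \<le> \<sigma>"
  shows "\<bar>mpow z a\<bar> \<le> \<sigma> ^ mdeg a"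
  unfolding mpow_def mdeg_def
  by (rule abs_mpow_remove_le) (rule order_trans[OF component_le_norm_cart assms])

lemma psum_has_sum:
  assumes c: "converges_within c \<rho>" and z: "norm z < \<rho>"
  shows "((\<lambda>a. c a * mpow z a) has_sum psum c z) UNIV"
proof -
  obtain \<sigma> where s: "norm z < \<sigma>" "\<sigma> < \<rho>" using dense[OF z] by blast
  have "0 < \<sigma>" using s(1) norm_ge_zero[of z] by linarith
  then have "(\<lambda>a. \<bar>c a\<bar> * \<sigma> ^ mdeg a) summable_on UNIV"
    using c s unfolding converges_within_def by auto
  then have "(\<lambda>a. norm (c a * mpow z a)) summable_on UNIV"
    by (rule summable_on_comparison_test)
       (use s in \<open>simp_all add: abs_mult mult_left_mono abs_mpow_le\<close>)
  then show ?thesis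
    unfolding psum_def by (rule has_sum_infsum[OF abs_summable_summable])
qed

section \<open>Termwise differentiation of a power series\<close>

lemma square_mult_geometric_bounded:
  fixes \<sigma> \<rho> :: real
  assumes "0 < \<sigma>" "\<sigma> < \<rho>"
  obtains K where "K > 0" "\<And>m::nat. (real m)\<^sup>2 * \<sigma> ^ m \<le> K * \<rho> ^ m"
proof -
  \<comment> \<open>With \<open>\<sigma> / \<rho>\<close> written as a square, each of the two
    factors \<open>m\<close> gets its own \<open>q ^ m\<close>, and the null sequence
    \<open>m * q ^ m\<close> is bounded.\<close>
  define q where "q = sqrt (\<sigma> / \<rho>)"
  have q: "0 \<le> q" "q < 1" "q\<^sup>2 = \<sigma> / \<rho>" using assms by (auto simp: q_def)
  have "(\<lambda>m. of_nat m * q ^ m) \<longlonglongrightarrow> 0" by (rule powser_times_n_limit_0) (use q in auto)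
  then have "Bseq (\<lambda>m. of_nat m * q ^ m)" by (intro convergent_imp_Bseq convergentI)
  then obtain k where k: "k > 0" "\<And>m. norm (of_nat m * q ^ m) \<le> k" by (auto elim: BseqE)
  have "(real m)\<^sup>2 * \<sigma> ^ m \<le> k\<^sup>2 * \<rho> ^ m" for m
  proof -
    have "(real m * q ^ m)\<^sup>2 \<le> k\<^sup>2" using k(2)[of m] q by (intro power_mono) auto
    moreover have "(real m * q ^ m)\<^sup>2 = (real m)\<^sup>2 * (\<sigma> / \<rho>) ^ m"
      by (simp add: power_mult_distrib q(3)[symmetric] power_mult[symmetric] mult.commute)
    ultimately have "(real m)\<^sup>2 * (\<sigma> / \<rho>) ^ m * \<rho> ^ m \<le> k\<^sup>2 * \<rho> ^ m"
      using assms by (intro mult_right_mono) auto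
    then show ?thesis using assms by (simp add: power_divide)
  qed
  with k(1) that[of "k\<^sup>2"] show thesis by simp
qed

text \<open>The square of the exponent is the growth of the Taylor remainder of a monomial along one
  axis. A radius \<open>\<tau>\<close> between \<open>\<sigma>\<close> and \<open>\<rho>\<close>
  supplies the majorant.\<close>

lemma converges_within_square_weight:
  assumes c: "converges_within c \<rho>" and s: "0 < \<sigma>" "\<sigma> < \<rho>"
  shows "(\<lambda>a. \<bar>c a\<bar> * ((real (a i))\<^sup>2 * \<sigma> ^ mdeg a)) summable_on UNIV"
proof -
  obtain \<tau> where t: "\<sigma> < \<tau>" "\<tau> < \<rho>" using dense s by blast
  obtain K where K: "\<And>m::nat. (real m)\<^sup>2 * \<sigma> ^ m \<le> K * \<tau> ^ m"
    using square_mult_geometric_bounded[OF s(1) t(1)] by metis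
  have "(\<lambda>a. K * (\<bar>c a\<bar> * \<tau> ^ mdeg a)) summable_on UNIV"
    using c s t unfolding converges_within_def by (intro summable_on_cmult_right) auto
  moreover have "\<bar>c a\<bar> * ((real (a i))\<^sup>2 * \<sigma> ^ mdeg a) \<le> K * (\<bar>c a\<bar> * \<tau> ^ mdeg a)" for a
  proof -
    have "(real (a i))\<^sup>2 * \<sigma> ^ mdeg a \<le> (real (mdeg a))\<^sup>2 * \<sigma> ^ mdeg a"
      using le_mdeg[of a i] s by (intro mult_right_mono power_mono) auto
    also have "\<dots> \<le> K * \<tau> ^ mdeg a" by (rule K)
    finally show ?thesis by (metis abs_ge_zero mult.left_commute mult_left_mono)
  qed
  ultimately show ?thesis
    by (rule summable_on_comparison_test) (use s in auto)
qed

text \<open>Raising the i-th exponent is injective, and the indices it misses have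
  \<open>a i = 0\<close>, where the factor \<open>real (a i)\<close> cancels the term despite
  truncated subtraction. The free weight \<open>g\<close> serves both values (\<open>mpow z\<close>)
  and majorants (powers of the radius).\<close>

lemma has_sum_partial_coeff_iff:
  "((\<lambda>a. partial_coeff i c a * g a) has_sum s) UNIV \<longleftrightarrow>
   ((\<lambda>a. c a * (real (a i) * g (a(i := a i - 1)))) has_sum s) UNIV"
proof -
  let ?up = "\<lambda>a. a(i := Suc (a i))"
  have inj: "inj ?up"
    by (rule inj_on_inverseI[of _ "\<lambda>a. a(i := a i - 1)"]) auto
  have zero: "a i = 0" if "a \<notin> range ?up" for a
  proof (rule ccontr)
    assume "a i \<noteq> 0"
    then have "a = ?up (a(i := a i - 1))" by auto
    with that show False by blast
  qed
  have "((\<lambda>a. c a * (real (a i) * g (a(i := a i - 1)))) has_sum s) UNIV \<longleftrightarrow>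
        ((\<lambda>a. c a * (real (a i) * g (a(i := a i - 1)))) has_sum s) (range ?up)"
    by (rule has_sum_cong_neutral) (use zero in auto)
  also have "\<dots> \<longleftrightarrow> ((\<lambda>a. partial_coeff i c a * g a) has_sum s) UNIV"
    by (subst has_sum_reindex[OF inj]) (simp add: o_def partial_coeff_def mult_ac)
  finally show ?thesis by simp
qed

lemma converges_within_partial_coeff:
  assumes c: "converges_within c \<rho>"
  shows "converges_within (partial_coeff i c) \<rho>"
  unfolding converges_within_def
proof (intro allI impI)
  fix \<sigma> :: real assume s: "0 < \<sigma>" "\<sigma> < \<rho>"
  have "(\<lambda>a. \<bar>c a\<bar> * (real (a i) * \<sigma> ^ mdeg (a(i := a i - 1)))) summable_on UNIV"
  proof (rule summable_on_comparison_test)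
    \<comment> \<open>The lowered exponent costs one factor \<open>\<sigma>\<close>, and the single
      factor \<open>a i\<close> is at most its square; for \<open>a i = 0\<close> both sides
      vanish.\<close>
    show "(\<lambda>a. (1 / \<sigma>) * (\<bar>c a\<bar> * ((real (a i))\<^sup>2 * \<sigma> ^ mdeg a))) summable_on UNIV"
      by (intro summable_on_cmult_right converges_within_square_weight[OF c s])
    fix a
    show "\<bar>c a\<bar> * (real (a i) * \<sigma> ^ mdeg (a(i := a i - 1)))
      \<le> (1 / \<sigma>) * (\<bar>c a\<bar> * ((real (a i))\<^sup>2 * \<sigma> ^ mdeg a))"
    proof (cases "a i")
      case (Suc k)
      have "mdeg a = Suc (mdeg (a(i := k)))"
        by (simp add: mdeg_remove[of _ i] Suc)
      moreover have "real (Suc k) \<le> (real (Suc k))\<^sup>2" by (simp add: power2_eq_square)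
      ultimately show ?thesis
        using s by (simp add: Suc mult_left_mono mult_right_mono del: of_nat_Suc)
    qed auto
  qed (use s in auto)
  moreover have "\<bar>partial_coeff i c a\<bar> = partial_coeff i (\<lambda>a. \<bar>c a\<bar>) a" for a
    by (simp add: partial_coeff_def abs_mult)
  ultimately show "(\<lambda>a. \<bar>partial_coeff i c a\<bar> * \<sigma> ^ mdeg a) summable_on UNIV"
    by (simp add: summable_on_def has_sum_partial_coeff_iff)
qed

lemma has_derivative_quadratic_remainder:
  assumes "bounded_linear f'" "0 < e"
    and "\<And>h. norm h < e \<Longrightarrow> norm (f (x + h) - f x - f' h) \<le> K * (norm h)\<^sup>2"
  shows "(f has_derivative f') (at x)"
proof (rule has_derivativeI_sandwich[OF assms(2,1)])
  show "((\<lambda>y. K * norm (y - x)) \<longlongrightarrow> 0) (at x)"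
    by (rule tendsto_eq_intros | simp)+
  fix y assume "y \<noteq> x" "dist y x < e"
  then show "norm (f y - f x - f' (y - x)) / norm (y - x) \<le> K * norm (y - x)"
    using assms(3)[of "y - x"] by (simp add: dist_norm divide_simps power2_eq_square mult.assoc)
qed

text \<open>The remainders satisfy a recurrence (\<open>rec\<close> below) that adds at most
  \<open>k\<close> to the coefficient \<open>k^2\<close>, and \<open>k^2 + k\<close> is at most
  \<open>(k + 1)^2\<close>. Keeping \<open>R\<^sup>2\<close> on the left avoids both the exponent
  \<open>k - 2\<close> and division by \<open>R\<close>.\<close>

lemma power_linear_remainder:
  fixes x t R :: real
  assumes "\<bar>x\<bar> \<le> R" "\<bar>x + t\<bar> \<le> R"
  shows "\<bar>(x + t) ^ k - x ^ k - t * (real k * x ^ (k - 1))\<bar> * R\<^sup>2 \<le> t\<^sup>2 * ((real k)\<^sup>2 * R ^ k)"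
proof (induction k)
  case (Suc k)
  let ?r = "\<lambda>k. (x + t) ^ k - x ^ k - t * (real k * x ^ (k - 1))"
  have R: "0 \<le> R" using assms by linarith
  have rec: "?r (Suc k) = (x + t) * ?r k + t\<^sup>2 * (real k * x ^ (k - 1))"
    by (cases k) (simp_all add: algebra_simps power2_eq_square)
  have pow: "real k * \<bar>x ^ (k - 1)\<bar> * R\<^sup>2 \<le> real k * R ^ Suc k"
  proof (cases k)
    case (Suc l)
    have "\<bar>x ^ l\<bar> \<le> R ^ l" using assms by (auto simp: power_abs intro: power_mono)
    then have "real k * R\<^sup>2 * \<bar>x ^ l\<bar> \<le> real k * R\<^sup>2 * R ^ l" by (rule mult_left_mono) auto
    then show ?thesis using R
      by (simp add: Suc power2_eq_square mult_ac del: of_nat_Suc)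
  qed simp
  have "\<bar>?r (Suc k)\<bar> * R\<^sup>2 \<le> (\<bar>x + t\<bar> * \<bar>?r k\<bar> + t\<^sup>2 * (real k * \<bar>x ^ (k - 1)\<bar>)) * R\<^sup>2"
    unfolding rec by (intro mult_right_mono order_trans[OF abs_triangle_ineq]) (simp_all add: abs_mult)
  also have "\<dots> = \<bar>x + t\<bar> * (\<bar>?r k\<bar> * R\<^sup>2) + t\<^sup>2 * (real k * \<bar>x ^ (k - 1)\<bar> * R\<^sup>2)"
    by (simp add: algebra_simps)
  also have "\<dots> \<le> R * (t\<^sup>2 * ((real k)\<^sup>2 * R ^ k)) + t\<^sup>2 * (real k * R ^ Suc k)"
    by (intro add_mono mult_mono Suc pow assms) (use R in auto)
  also have "\<dots> = t\<^sup>2 * (((real k)\<^sup>2 + real k) * R ^ Suc k)" by (simp add: algebra_simps)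
  also have "\<dots> \<le> t\<^sup>2 * ((real (Suc k))\<^sup>2 * R ^ Suc k)"
    using R by (intro mult_left_mono mult_right_mono) (auto simp: power2_eq_square algebra_simps)
  finally show ?case .
qed simp

text \<open>A move along one axis changes a single factor, so the remainder is the one-variable
  remainder times the untouched product \<open>?Q\<close>.\<close>

lemma mpow_axis_remainder:
  assumes "\<And>j. \<bar>z $ j\<bar> \<le> \<sigma>" "\<bar>z $ i + t\<bar> \<le> \<sigma>" "0 < \<sigma>"
  shows "\<bar>mpow (z + t *\<^sub>R axis i 1) a - mpow z a - t * (real (a i) * mpow z (a(i := a i - 1)))\<bar>
    \<le> t\<^sup>2 / \<sigma>\<^sup>2 * ((real (a i))\<^sup>2 * \<sigma> ^ mdeg a)"
proof -
  let ?Q = "\<Prod>j\<in>UNIV - {i}. z $ j ^ a j"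
  let ?r = "(z $ i + t) ^ a i - z $ i ^ a i - t * (real (a i) * z $ i ^ (a i - 1))"
  have "mpow (z + t *\<^sub>R axis i 1) a = (z $ i + t) ^ a i * ?Q"
    by (simp add: mpow_remove[of _ _ i] axis_def)
  moreover have "mpow z (a(i := a i - 1)) = z $ i ^ (a i - 1) * ?Q"
    by (simp add: mpow_remove[of _ _ i])
  ultimately have "mpow (z + t *\<^sub>R axis i 1) a - mpow z a - t * (real (a i) * mpow z (a(i := a i - 1)))
      = ?r * ?Q"
    by (simp add: mpow_remove[of z a i] algebra_simps)
  then have "\<bar>mpow (z + t *\<^sub>R axis i 1) a - mpow z a - t * (real (a i) * mpow z (a(i := a i - 1)))\<bar> * \<sigma>\<^sup>2
      = (\<bar>?r\<bar> * \<sigma>\<^sup>2) * \<bar>?Q\<bar>"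
    by (simp add: abs_mult mult_ac)
  also have "\<dots> \<le> (t\<^sup>2 * ((real (a i))\<^sup>2 * \<sigma> ^ a i)) * \<sigma> ^ (\<Sum>j\<in>UNIV - {i}. a j)"
    by (intro mult_mono power_linear_remainder abs_mpow_remove_le assms) (use assms in auto)
  also have "\<dots> = t\<^sup>2 * ((real (a i))\<^sup>2 * \<sigma> ^ mdeg a)"
    by (simp add: mdeg_remove[of a i] power_add)
  finally show ?thesis using assms(3) by (simp add: field_simps)
qed

lemma has_sum_diff:
  fixes f g :: "'a \<Rightarrow> 'b::topological_ab_group_add"
  assumes "(f has_sum a) A" "(g has_sum b) A"
  shows "((\<lambda>x. f x - g x) has_sum (a - b)) A"
  using has_sum_add[OF assms(1), of "\<lambda>x. - g x" "- b"] assms(2) by (simp add: has_sum_uminus)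

text \<open>The monomial remainders add up to at most a constant times \<open>t\<^sup>2\<close>. The
  constant \<open>W\<close> does not depend on \<open>t\<close>, because for small \<open>t\<close>
  all coordinates stay within \<open>\<sigma>\<close>; no separate uniform convergence argument is
  made.\<close>

lemma psum_has_partial_derivative:
  assumes c: "converges_within c \<rho>" and z: "norm z < \<rho>"
  shows "((\<lambda>t. psum c (z + t *\<^sub>R axis i 1)) has_real_derivative psum (partial_coeff i c) z) (at 0)"
proof -
  obtain \<sigma> where s: "norm z < \<sigma>" "\<sigma> < \<rho>" using dense[OF z] by blast
  have s0: "0 < \<sigma>" using s(1) norm_ge_zero[of z] by linarith
  define W where "W = (\<Sum>\<^sub>\<infinity>a. \<bar>c a\<bar> * ((real (a i))\<^sup>2 * \<sigma> ^ mdeg a))"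
  have W: "((\<lambda>a. \<bar>c a\<bar> * ((real (a i))\<^sup>2 * \<sigma> ^ mdeg a)) has_sum W) UNIV"
    unfolding W_def by (intro has_sum_infsum converges_within_square_weight[OF c s0 s(2)])
  have bound: "\<bar>psum c (z + t *\<^sub>R axis i 1) - psum c z - t * psum (partial_coeff i c) z\<bar>
      \<le> t\<^sup>2 / \<sigma>\<^sup>2 * W" if t: "\<bar>t\<bar> < \<sigma> - norm z" for t
  proof -
    have zs: "\<bar>z $ j\<bar> \<le> norm z" for j by (rule component_le_norm_cart)
    have "norm (z + t *\<^sub>R axis i 1) \<le> norm z + \<bar>t\<bar>"
      by (rule order_trans[OF norm_triangle_ineq]) (simp add: norm_axis_1)
    then have "norm (z + t *\<^sub>R axis i 1) < \<rho>" using t s by linarith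
    then have "((\<lambda>a. c a * mpow (z + t *\<^sub>R axis i 1) a - c a * mpow z a
        - t * (c a * (real (a i) * mpow z (a(i := a i - 1))))) has_sum
        (psum c (z + t *\<^sub>R axis i 1) - psum c z - t * psum (partial_coeff i c) z)) UNIV"
      by (intro has_sum_diff has_sum_cmult_right psum_has_sum[OF c] z
            has_sum_partial_coeff_iff[THEN iffD1] psum_has_sum[OF converges_within_partial_coeff[OF c]])
    then have "norm (psum c (z + t *\<^sub>R axis i 1) - psum c z - t * psum (partial_coeff i c) z)
        \<le> t\<^sup>2 / \<sigma>\<^sup>2 * W"
    proof (rule norm_infsum_le[OF _ has_sum_cmult_right[OF W]])
      fix a
      have "norm (c a * mpow (z + t *\<^sub>R axis i 1) a - c a * mpow z a
          - t * (c a * (real (a i) * mpow z (a(i := a i - 1)))))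
        = \<bar>c a\<bar> * \<bar>mpow (z + t *\<^sub>R axis i 1) a - mpow z a - t * (real (a i) * mpow z (a(i := a i - 1)))\<bar>"
        by (simp add: abs_mult[symmetric] algebra_simps)
      also have "\<dots> \<le> \<bar>c a\<bar> * (t\<^sup>2 / \<sigma>\<^sup>2 * ((real (a i))\<^sup>2 * \<sigma> ^ mdeg a))"
      proof (intro mult_left_mono mpow_axis_remainder s0)
        show "\<bar>z $ j\<bar> \<le> \<sigma>" for j using zs[of j] s by linarith
        show "\<bar>z $ i + t\<bar> \<le> \<sigma>" using zs[of i] t by linarith
      qed simp
      finally show "norm (c a * mpow (z + t *\<^sub>R axis i 1) a - c a * mpow z a
          - t * (c a * (real (a i) * mpow z (a(i := a i - 1)))))
        \<le> t\<^sup>2 / \<sigma>\<^sup>2 * (\<bar>c a\<bar> * ((real (a i))\<^sup>2 * \<sigma> ^ mdeg a))"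
        by (simp add: mult_ac)
    qed
    then show ?thesis by simp
  qed
  show ?thesis
    unfolding has_field_derivative_def
  proof (rule has_derivative_quadratic_remainder[where e = "\<sigma> - norm z" and K = "W / \<sigma>\<^sup>2"])
    show "bounded_linear ((*) (psum (partial_coeff i c) z))" by (rule bounded_linear_mult_right)
  qed (use bound s in \<open>auto simp: mult_ac\<close>)
qed

section \<open>Quadratic remainder of a power series\<close>

lemma mdeg_less_2_iff:
  "mdeg a < 2 \<longleftrightarrow> a \<in> insert (\<lambda>_. 0) (range (\<lambda>k. (\<lambda>_. 0)(k := 1)))"
proof
  assume "mdeg a < 2"
  then consider "mdeg a = 0" | "mdeg a = 1" by linarith
  then show "a \<in> insert (\<lambda>_. 0) (range (\<lambda>k. (\<lambda>_. 0)(k := 1)))"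
  proof cases
    case 1
    then have "a = (\<lambda>_. 0)" by (auto simp: mdeg_def)
    then show ?thesis by blast
  next
    case 2
    then obtain k where "a k = 1" "\<forall>j. k \<noteq> j \<longrightarrow> a j = 0"
      unfolding mdeg_def sum_eq_1_iff[OF finite] by blast
    then have "a = (\<lambda>_. 0)(k := 1)" by auto
    then show ?thesis by blast
  qed
qed (auto simp: mdeg_def)

text \<open>The finite set \<open>F\<close> carries the constant and linear terms. Every other index
  has degree at least 2, so for \<open>norm z \<le> \<sigma>\<close> two factors
  \<open>norm z\<close> can be pulled out and the rest replaced by powers of
  \<open>\<sigma>\<close>.\<close>

lemma psum_linear_remainder:
  fixes c :: "('n::finite \<Rightarrow> nat) \<Rightarrow> real"
  assumes c: "converges_within c \<rho>" and s: "0 < \<sigma>" "\<sigma> < \<rho>"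
  obtains K where "\<And>z. norm z \<le> \<sigma> \<Longrightarrow>
    \<bar>psum c z - psum c 0 - (\<Sum>k\<in>UNIV. c ((\<lambda>_. 0)(k := 1)) * z $ k)\<bar> \<le> K * (norm z)\<^sup>2"
proof -
  let ?e = "\<lambda>k::'n. (\<lambda>_. 0::nat)(k := 1)"
  define F where "F = insert (\<lambda>_. 0) (range ?e)"
  have inj: "inj ?e" by (rule injI) (metis fun_upd_apply zero_neq_one)
  have e0: "(\<lambda>_. 0) \<notin> range ?e"
  proof
    assume "(\<lambda>_. 0) \<in> range ?e"
    then obtain k where "(\<lambda>_. 0) = ?e k" by blast
    from fun_cong[OF this, of k] show False by simp
  qed
  have mp0: "mpow z (\<lambda>_. 0) = 1" for z :: "real^'n" by (simp add: mpow_def)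
  have mpe: "mpow z (?e k) = z $ k" for z :: "real^'n" and k
    by (simp add: mpow_remove[of z _ k])
  have sumF: "(\<Sum>a\<in>F. c a * mpow z a) = c (\<lambda>_. 0) + (\<Sum>k\<in>UNIV. c (?e k) * z $ k)" for z
    unfolding F_def using e0 inj by (simp add: sum.reindex mp0 mpe del: One_nat_def)
  define W where "W = (\<Sum>\<^sub>\<infinity>a\<in>-F. \<bar>c a\<bar> * \<sigma> ^ mdeg a)"
  have "(\<lambda>a. \<bar>c a\<bar> * \<sigma> ^ mdeg a) summable_on UNIV"
    using c s unfolding converges_within_def by auto
  then have W: "((\<lambda>a. \<bar>c a\<bar> * \<sigma> ^ mdeg a) has_sum W) (-F)"
    unfolding W_def by (intro has_sum_infsum) (rule summable_on_subset_banach, auto)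
  have tail: "((\<lambda>a. c a * mpow z a) has_sum
      (psum c z - c (\<lambda>_. 0) - (\<Sum>k\<in>UNIV. c (?e k) * z $ k))) (-F)" if "norm z < \<rho>" for z
  proof -
    have "((\<lambda>a. c a * mpow z a) has_sum (psum c z - (\<Sum>a\<in>F. c a * mpow z a))) (UNIV - F)"
      by (rule has_sum_Diff[OF psum_has_sum[OF c that] has_sum_finite]) (auto simp: F_def)
    then show ?thesis by (simp add: sumF Compl_eq_Diff_UNIV algebra_simps)
  qed
  have bound: "\<bar>psum c z - c (\<lambda>_. 0) - (\<Sum>k\<in>UNIV. c (?e k) * z $ k)\<bar> \<le> (norm z)\<^sup>2 / \<sigma>\<^sup>2 * W"
    if z: "norm z \<le> \<sigma>" for z
  proof -
    have "norm (psum c z - c (\<lambda>_. 0) - (\<Sum>k\<in>UNIV. c (?e k) * z $ k)) \<le> (norm z)\<^sup>2 / \<sigma>\<^sup>2 * W"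
    proof (rule norm_infsum_le[OF tail has_sum_cmult_right[OF W]])
      show "norm z < \<rho>" using z s by linarith
      fix a assume "a \<in> -F"
      then have "2 \<le> mdeg a" using mdeg_less_2_iff[of a] by (auto simp: F_def)
      then obtain m where m: "mdeg a = 2 + m" using le_Suc_ex by blast
      have "\<bar>mpow z a\<bar> \<le> (norm z)\<^sup>2 * norm z ^ m"
        using abs_mpow_le[OF order_refl, of z a] by (simp only: m power_add)
      also have "\<dots> \<le> (norm z)\<^sup>2 * \<sigma> ^ m" using z by (intro mult_left_mono power_mono) auto
      also have "\<dots> = (norm z)\<^sup>2 / \<sigma>\<^sup>2 * \<sigma> ^ mdeg a" using s by (simp add: m power2_eq_square)
      finally have "\<bar>c a\<bar> * \<bar>mpow z a\<bar> \<le> \<bar>c a\<bar> * ((norm z)\<^sup>2 / \<sigma>\<^sup>2 * \<sigma> ^ mdeg a)"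
        by (rule mult_left_mono) simp
      then show "norm (c a * mpow z a) \<le> (norm z)\<^sup>2 / \<sigma>\<^sup>2 * (\<bar>c a\<bar> * \<sigma> ^ mdeg a)"
        by (simp add: abs_mult mult_ac)
    qed
    then show ?thesis by simp
  qed
  \<comment> \<open>At \<open>z = 0\<close> the linear terms and the right-hand side vanish, so the
    bound itself identifies the constant coefficient.\<close>
  have "psum c 0 = c (\<lambda>_. 0)" using bound[of 0] s by simp
  with bound show thesis by (intro that[of "W / \<sigma>\<^sup>2"]) (simp add: mult_ac)
qed

section \<open>Hessians of analytic functions\<close>

text \<open>Near \<open>t = 0\<close> the function and the series agree along the axis, so
  uniqueness of the derivative identifies their slopes. With \<open>f\<close> general, this applies
  first to the objective and then to each component of its gradient.\<close>

lemma derivative_axis_eq_psum: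
  assumes c: "converges_within c \<rho>" and z: "norm z < \<rho>"
    and eq: "\<And>z. norm z < \<rho> \<Longrightarrow> f (y + z) = psum c z"
    and f': "(f has_derivative f') (at (y + z))"
  shows "f' (axis i 1) = psum (partial_coeff i c) z"
proof -
  have "((\<lambda>t. f (y + z + t *\<^sub>R axis i 1)) has_derivative (\<lambda>t. f' (t *\<^sub>R axis i 1))) (at (0::real))"
    by (rule has_derivative_compose[where g = f and f = "\<lambda>t::real. y + z + t *\<^sub>R axis i 1"])
       (use f' in \<open>auto intro!: derivative_eq_intros\<close>)
  moreover have "(\<lambda>t. f' (t *\<^sub>R axis i 1)) = (*) (f' (axis i 1))"
    using linear_scale[OF has_derivative_linear[OF f']] by (auto simp: mult.commute)
  ultimately have 1: "((\<lambda>t. f (y + z + t *\<^sub>R axis i 1)) has_real_derivative f' (axis i 1)) (at 0)"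
    by (simp add: has_field_derivative_def)
  have "\<forall>\<^sub>F t in nhds 0. \<bar>t\<bar> < \<rho> - norm z"
    using eventually_nhds_ball[of "\<rho> - norm z" "0::real"] z by (simp add: dist_norm)
  then have ev: "\<forall>\<^sub>F t in nhds 0. f (y + z + t *\<^sub>R axis i 1) = psum c (z + t *\<^sub>R axis i 1)"
  proof eventually_elim
    case (elim t)
    have "norm (z + t *\<^sub>R axis i 1) \<le> norm z + \<bar>t\<bar>"
      by (rule order_trans[OF norm_triangle_ineq]) (simp add: norm_axis_1)
    then show ?case using elim eq[of "z + t *\<^sub>R axis i 1"] by (simp add: add.assoc)
  qed
  have "((\<lambda>t. psum c (z + t *\<^sub>R axis i 1)) has_real_derivative f' (axis i 1)) (at 0)"
    by (rule DERIV_cong_ev[OF refl ev refl, THEN iffD1, OF 1])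
  then show ?thesis
    by (rule DERIV_unique[OF _ psum_has_partial_derivative[OF c z]])
qed

text \<open>\<open>grad\<close> is a definite description. The representing vector
  \<open>adjoint f' 1\<close> gives existence, and uniqueness of the Frechet derivative gives
  uniqueness.\<close>

lemma has_derivative_grad:
  assumes "f differentiable (at x)"
  shows "(f has_derivative (\<lambda>h. h \<bullet> grad f x)) (at x)"
proof -
  obtain f' where f': "(f has_derivative f') (at x)" using assms unfolding differentiable_def by blast
  have "f' h = h \<bullet> adjoint f' 1" for h
    using adjoint_works[OF has_derivative_linear[OF f'], of h 1] by simp
  then have "f' = (\<lambda>h. h \<bullet> adjoint f' 1)" by (rule ext)
  then have D: "GDERIV f x :> adjoint f' 1" using f' by (simp add: gderiv_def)
  then have "GDERIV f x :> grad f x"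
    unfolding grad_def
  proof (rule theI)
    fix D' assume "GDERIV f x :> D'"
    then have "(\<lambda>h. h \<bullet> D') = (\<lambda>h. h \<bullet> adjoint f' 1)"
      using D unfolding gderiv_def by (rule has_derivative_unique)
    then have "\<forall>h. h \<bullet> D' = h \<bullet> adjoint f' 1" by (rule fun_cong[THEN allI])
    then show "D' = adjoint f' 1" unfolding vector_eq_ldot .
  qed
  then show ?thesis by (simp add: gderiv_def)
qed

text \<open>At the diagonal point with all coordinates \<open>\<rho>\<close>, every monomial equals
  \<open>\<rho> ^ mdeg a\<close>. Real summability over an index set is absolute, so this one point
  yields the majorant for all smaller radii.\<close>

lemma real_analytic_onE:
  fixes f :: "real^'n \<Rightarrow> real"
  assumes "real_analytic_on f U" "y \<in> U"
  obtains c \<rho> where "0 < \<rho>" "converges_within c \<rho>" "\<And>z. norm z < \<rho> \<Longrightarrow> f (y + z) = psum c z"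
proof -
  obtain c e where e: "e > 0"
    and sum: "\<And>x. x \<in> ball y e \<Longrightarrow> ((\<lambda>a. c a * (\<Prod>i\<in>UNIV. (x $ i - y $ i) ^ a i)) has_sum f x) UNIV"
    using assms unfolding real_analytic_on_def by blast
  have sum': "((\<lambda>a. c a * mpow z a) has_sum f (y + z)) UNIV" if "norm z < e" for z
    using sum[of "y + z"] that by (simp add: mpow_def dist_norm)
  \<comment> \<open>This makes the l1 norm of the diagonal point \<open>e / 2\<close>, which keeps
    it inside the ball of radius \<open>e\<close>.\<close>
  define \<rho> where "\<rho> = e / (2 * real CARD('n))"
  have "1 \<le> CARD('n)" by (simp add: Suc_leI)
  then have "1 < 2 * real CARD('n)" by linarith
  then have "e * 1 < e * (2 * real CARD('n))" using e by (rule mult_strict_left_mono)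
  then have r: "0 < \<rho>" "\<rho> < e" using e by (simp_all add: \<rho>_def pos_divide_less_eq)
  have "norm (\<chi> i::'n. \<rho>) \<le> (\<Sum>i::'n\<in>UNIV. \<bar>\<rho>\<bar>)"
    using norm_le_l1_cart[of "\<chi> i::'n. \<rho>"] by simp
  also have "\<dots> < e" using e by (simp add: \<rho>_def)
  finally have "(\<lambda>a. c a * mpow (\<chi> i::'n. \<rho>) a) summable_on UNIV"
    using sum' by (meson summable_on_def)
  moreover have "mpow (\<chi> i::'n. \<rho>) a = \<rho> ^ mdeg a" for a
    by (simp add: mpow_def mdeg_def power_sum)
  ultimately have summ: "(\<lambda>a. \<bar>c a\<bar> * \<rho> ^ mdeg a) summable_on UNIV"
    using r by (simp add: summable_on_iff_abs_summable_on_real[of "\<lambda>a. c a * _ a"] abs_mult)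
  have conv: "converges_within c \<rho>"
    unfolding converges_within_def
  proof (intro allI impI)
    fix \<sigma> :: real assume "0 < \<sigma>" "\<sigma> < \<rho>"
    then show "(\<lambda>a. \<bar>c a\<bar> * \<sigma> ^ mdeg a) summable_on UNIV"
      by (intro summable_on_comparison_test[OF summ]) (auto intro!: mult_left_mono power_mono)
  qed
  show thesis
  proof (rule that[OF r(1) conv])
    fix z :: "real^'n" assume z: "norm z < \<rho>"
    then show "f (y + z) = psum c z"
      using has_sum_unique[OF sum' psum_has_sum[OF conv z]] r by simp
  qed
qed

lemma norm_matrix_le_sum:
  fixes A :: "real^'n^'m"
  shows "norm A \<le> (\<Sum>i\<in>UNIV. \<Sum>j\<in>UNIV. \<bar>A $ i $ j\<bar>)"
proof -
  have "norm A \<le> (\<Sum>i\<in>UNIV. norm (A $ i))" unfolding norm_vec_def by (rule L2_set_le_sum) simp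
  also have "\<dots> \<le> (\<Sum>i\<in>UNIV. \<Sum>j\<in>UNIV. \<bar>A $ i $ j\<bar>)" by (intro sum_mono norm_le_l1_cart)
  finally show ?thesis .
qed

text \<open>The axis lemma is used twice: for \<open>f\<close> it gives the i-th gradient component
  as a series, and for that component it gives entry \<open>j\<close> of row \<open>i\<close> of the
  Jacobian.\<close>

lemma hess_nth_eq_psum:
  assumes df: "\<And>x. f differentiable (at x)" and dg: "\<And>x. grad f differentiable (at x)"
    and c: "converges_within c \<rho>" and eq: "\<And>z. norm z < \<rho> \<Longrightarrow> f (y + z) = psum c z"
    and z: "norm z < \<rho>"
  shows "hess f (y + z) $ i $ j = psum (partial_coeff j (partial_coeff i c)) z"
proof -
  have grad: "grad f (y + z) $ i = psum (partial_coeff i c) z" if "norm z < \<rho>" for z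
    using derivative_axis_eq_psum[OF c that eq has_derivative_grad[OF df], of i]
    by (simp add: inner_axis')
  have "(grad f has_derivative (\<lambda>h. hess f (y + z) *v h)) (at (y + z))"
    using dg[of "y + z"] unfolding jacobian_works hess_def .
  then have "((\<lambda>x. grad f x $ i) has_derivative (\<lambda>h. (hess f (y + z) *v h) $ i)) (at (y + z))"
    by (rule bounded_linear.has_derivative[OF bounded_linear_vec_nth])
  from derivative_axis_eq_psum[OF converges_within_partial_coeff[OF c] z grad this, of j]
  show ?thesis by (simp add: matrix_vector_mul_component inner_axis)
qed

lemma hess_expansion:
  fixes f :: "real^'n \<Rightarrow> real"
  assumes df: "\<And>x. f differentiable (at x)" and dg: "\<And>x. grad f differentiable (at x)"
    and an: "real_analytic_on f U" "y \<in> U"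
  obtains B K \<rho> where "0 < \<rho>" "bounded_linear B" "\<And>z. transpose (B z) = B z"
    "\<And>z. norm z \<le> \<rho> \<Longrightarrow> norm (hess f (y + z) - hess f y - B z) \<le> K * (norm z)\<^sup>2"
proof -
  obtain c \<rho> where r: "0 < \<rho>" and c: "converges_within c \<rho>"
    and eq: "\<And>z. norm z < \<rho> \<Longrightarrow> f (y + z) = psum c z"
    using real_analytic_onE[OF an] by metis
  let ?d = "\<lambda>i j. partial_coeff j (partial_coeff i c)"
  have hess: "hess f (y + z) $ i $ j = psum (?d i j) z" if "norm z < \<rho>" for z i j
    by (rule hess_nth_eq_psum[OF df dg c eq that])
  \<comment> \<open>Each entry collects the degree-one coefficients of the series of the
    corresponding Hessian entry.\<close>
  define B :: "real^'n \<Rightarrow> real^'n^'n"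
    where "B z = (\<chi> i j. \<Sum>k\<in>UNIV. ?d i j ((\<lambda>_. 0)(k := 1)) * z $ k)" for z
  have "\<exists>K. \<forall>z. norm z \<le> \<rho> / 2 \<longrightarrow>
      \<bar>psum (?d i j) z - psum (?d i j) 0 - B z $ i $ j\<bar> \<le> K * (norm z)\<^sup>2" for i j
  proof -
    have "converges_within (?d i j) \<rho>" by (intro converges_within_partial_coeff c)
    then show ?thesis using psum_linear_remainder[of "?d i j" \<rho> "\<rho> / 2"] r
      unfolding B_def by auto
  qed
  then have "\<forall>i j. \<exists>K. \<forall>z. norm z \<le> \<rho> / 2 \<longrightarrow>
      \<bar>psum (?d i j) z - psum (?d i j) 0 - B z $ i $ j\<bar> \<le> K * (norm z)\<^sup>2" by blast
  then obtain K where K: "\<And>i j z. norm z \<le> \<rho> / 2 \<Longrightarrow>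
      \<bar>psum (?d i j) z - psum (?d i j) 0 - B z $ i $ j\<bar> \<le> K i j * (norm z)\<^sup>2"
    unfolding choice_iff by blast
  show thesis
  \<comment> \<open>The entrywise remainder bounds need a radius strictly inside
    \<open>\<rho>\<close>, hence the half; the entrywise constants are added because the Frobenius
    norm is at most the sum of the absolute entries.\<close>
  proof (rule that[of "\<rho> / 2" B "\<Sum>i\<in>UNIV. \<Sum>j\<in>UNIV. K i j"])
    show "0 < \<rho> / 2" using r by simp
    have "linear B"
      by (rule linearI)
         (auto simp: B_def vec_eq_iff algebra_simps sum.distrib sum_distrib_left)
    then show "bounded_linear B" by (simp add: linear_conv_bounded_linear)
    show "transpose (B z) = B z" for z
      by (simp add: transpose_def B_def vec_eq_iff partial_coeff_commute)
    fix z :: "real^'n" assume z: "norm z \<le> \<rho> / 2"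
    then have "norm z < \<rho>" using r by linarith
    then have nth: "(hess f (y + z) - hess f y - B z) $ i $ j
        = psum (?d i j) z - psum (?d i j) 0 - B z $ i $ j" for i j
      using hess[of z i j] hess[of 0 i j] r by simp
    have "norm (hess f (y + z) - hess f y - B z)
        \<le> (\<Sum>i\<in>UNIV. \<Sum>j\<in>UNIV. \<bar>psum (?d i j) z - psum (?d i j) 0 - B z $ i $ j\<bar>)"
      by (rule order_trans[OF norm_matrix_le_sum]) (simp only: nth order_refl)
    also have "\<dots> \<le> (\<Sum>i\<in>UNIV. \<Sum>j\<in>UNIV. K i j * (norm z)\<^sup>2)"
      by (intro sum_mono K z)
    finally show "norm (hess f (y + z) - hess f y - B z)
        \<le> (\<Sum>i\<in>UNIV. \<Sum>j\<in>UNIV. K i j) * (norm z)\<^sup>2"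
      by (simp add: sum_distrib_right)
  qed
qed

text \<open>Transfers the Lipschitz bound, given in the spectral norm, to the Frobenius norm of the
  remainder: each of the \<open>n^2\<close> entries is at most the operator norm.\<close>

lemma norm_matrix_le_spectral_norm:
  fixes A :: "real^'n^'n"
  shows "norm A \<le> (real CARD('n))\<^sup>2 * spectral_norm A"
proof -
  have "norm A \<le> (\<Sum>i::'n\<in>UNIV. \<Sum>j::'n\<in>UNIV. spectral_norm A)"
    by (rule order_trans[OF norm_matrix_le_sum])
       (intro sum_mono, simp add: spectral_norm_def matrix_component_le_onorm)
  then show ?thesis by (simp add: power2_eq_square mult_ac)
qed

section \<open>First-order perturbation of the spectral decomposition\<close>

lemma outer_mult_vec: "outer a b *v x = (b \<bullet> x) *\<^sub>R a"
  by (simp add: vec_eq_iff matrix_vector_mult_def outer_def inner_vec_def sum_distrib_left mult_ac)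

text \<open>With the vectors as rows of a square matrix \<open>V\<close>, orthonormality says that
  \<open>transpose V\<close> is a right inverse; for square matrices it is then also a left inverse,
  which is the expansion.\<close>

lemma orthonormal_expansion:
  fixes v :: "'n \<Rightarrow> real^'n"
  assumes v: "\<And>i l. v i \<bullet> v l = (if i = l then 1 else 0)"
  shows "x = (\<Sum>l\<in>UNIV. (v l \<bullet> x) *\<^sub>R v l)"
proof -
  define V :: "real^'n^'n" where "V = (\<chi> i. v i)"
  have "V ** transpose V = mat 1"
    using v by (simp add: vec_eq_iff V_def matrix_matrix_mult_def transpose_def mat_def inner_vec_def)
  then have VV: "transpose V ** V = mat 1" by (simp add: matrix_left_right_inverse)
  have "x = transpose V *v (V *v x)" by (simp add: matrix_vector_mul_assoc VV del: transpose_matrix_vector)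
  also have "\<dots> = (\<Sum>l\<in>UNIV. (v l \<bullet> x) *\<^sub>R v l)"
    by (simp add: vec_eq_iff matrix_vector_mult_def transpose_def V_def inner_vec_def mult.commute
        del: transpose_matrix_vector)
  finally show ?thesis .
qed

lemma matrix_vector_mult_sum_left:
  fixes A :: "'a \<Rightarrow> real^'n^'m"
  shows "(\<Sum>i\<in>I. A i) *v x = (\<Sum>i\<in>I. A i *v x)"
  by (induction I rule: infinite_finite_induct) (auto simp: matrix_vector_mult_add_rdistrib)

text \<open>Both sides are applied to an arbitrary \<open>x\<close>. Each of the three sums becomes
  a double sum of vectors \<open>v l\<close> weighted by \<open>v i \<bullet> x\<close>, and
  \<open>coeff\<close> adds their coefficients.\<close>

lemma symmetric_eq_eigenvector_perturbation:
  fixes S :: "real^'n^'n" and v :: "'n \<Rightarrow> real^'n" and lam :: "'n \<Rightarrow> real"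
  assumes S: "transpose S = S"
    and v: "\<And>i l. v i \<bullet> v l = (if i = l then 1 else 0)"
    and lam: "inj lam"
  shows "S = (\<Sum>i\<in>UNIV.
            (v i \<bullet> (S *v v i)) *\<^sub>R outer (v i) (v i)
          + lam i *\<^sub>R outer (\<Sum>l\<in>UNIV - {i}. ((v l \<bullet> (S *v v i)) / (lam i - lam l)) *\<^sub>R v l) (v i)
          + lam i *\<^sub>R outer (v i) (\<Sum>l\<in>UNIV - {i}. ((v l \<bullet> (S *v v i)) / (lam i - lam l)) *\<^sub>R v l))"
    (is "S = ?R")
proof -
  let ?c = "\<lambda>l i. v l \<bullet> (S *v v i)"
  \<comment> \<open>Division by zero makes the diagonal coefficients vanish, so the sums may run over all indices.\<close>
  let ?k = "\<lambda>l i. ?c l i / (lam i - lam l)"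
  define w where "w i = (\<Sum>l\<in>UNIV. ?k l i *\<^sub>R v l)" for i
  have w: "(\<Sum>l\<in>UNIV - {i}. ?k l i *\<^sub>R v l) = w i" for i
    by (simp add: w_def sum.remove[of UNIV i])
  have c_commute: "?c i l = ?c l i" for i l
    by (metis S dot_lmul_matrix inner_commute transpose_matrix_vector)
  have coeff: "(if l = i then ?c l i else 0) + lam i * ?k l i + lam l * ?k i l = ?c l i" for i l
  proof (cases "l = i")
    case False
    then have ne: "lam i - lam l \<noteq> 0" using lam by (auto dest: injD)
    then have "lam l * ?k i l = - (lam l * ?k l i)"
      by (simp add: c_commute[of i l] divide_simps) (simp add: algebra_simps)
    then have "lam i * ?k l i + lam l * ?k i l = (lam i - lam l) * ?k l i"
      by (simp only: left_diff_distrib)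
    then show ?thesis using ne False by simp
  qed simp
  have "?R *v x = S *v x" for x
  proof -
    have "?R *v x = (\<Sum>i\<in>UNIV. (?c i i * (v i \<bullet> x)) *\<^sub>R v i)
        + (\<Sum>i\<in>UNIV. (lam i * (v i \<bullet> x)) *\<^sub>R w i) + (\<Sum>i\<in>UNIV. (lam i * (w i \<bullet> x)) *\<^sub>R v i)"
      unfolding w matrix_vector_mult_sum_left matrix_vector_mult_add_rdistrib
        scaleR_matrix_vector_assoc[symmetric] outer_mult_vec sum.distrib scaleR_scaleR ..
    moreover have "(\<Sum>i\<in>UNIV. (?c i i * (v i \<bullet> x)) *\<^sub>R v i)
        = (\<Sum>i\<in>UNIV. \<Sum>l\<in>UNIV. ((if l = i then ?c l i else 0) * (v i \<bullet> x)) *\<^sub>R v l)"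
    proof (intro sum.cong refl)
      fix i
      have "(\<Sum>l\<in>UNIV. ((if l = i then ?c l i else 0) * (v i \<bullet> x)) *\<^sub>R v l)
          = (\<Sum>l\<in>UNIV. if l = i then (?c l l * (v l \<bullet> x)) *\<^sub>R v l else 0)"
        by (rule sum.cong) auto
      then show "(?c i i * (v i \<bullet> x)) *\<^sub>R v i
          = (\<Sum>l\<in>UNIV. ((if l = i then ?c l i else 0) * (v i \<bullet> x)) *\<^sub>R v l)"
        by (simp only: sum.delta[OF finite] UNIV_I if_True)
    qed
    moreover have "(\<Sum>i\<in>UNIV. (lam i * (v i \<bullet> x)) *\<^sub>R w i)
        = (\<Sum>i\<in>UNIV. \<Sum>l\<in>UNIV. (lam i * ?k l i * (v i \<bullet> x)) *\<^sub>R v l)"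
      unfolding w_def scaleR_sum_right scaleR_scaleR by (simp only: mult_ac)
    moreover have "(\<Sum>i\<in>UNIV. (lam i * (w i \<bullet> x)) *\<^sub>R v i)
        = (\<Sum>i\<in>UNIV. \<Sum>l\<in>UNIV. (lam l * ?k i l * (v i \<bullet> x)) *\<^sub>R v l)"
    proof -
      have "(\<Sum>i\<in>UNIV. (lam i * (w i \<bullet> x)) *\<^sub>R v i)
          = (\<Sum>i\<in>UNIV. \<Sum>l\<in>UNIV. (lam i * ?k l i * (v l \<bullet> x)) *\<^sub>R v i)"
        unfolding w_def inner_sum_left inner_scaleR_left sum_distrib_left scaleR_sum_left
        by (simp only: mult_ac)
      \<comment> \<open>Exchanging the roles of \<open>i\<close> and \<open>l\<close> brings the
        transposed term to the common form and turns its coefficient into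
        \<open>lam l * ?k i l\<close>.\<close>
      also have "\<dots> = (\<Sum>i\<in>UNIV. \<Sum>l\<in>UNIV. (lam l * ?k i l * (v i \<bullet> x)) *\<^sub>R v l)"
        by (rule sum.swap)
      finally show ?thesis .
    qed
    ultimately have "?R *v x = (\<Sum>i\<in>UNIV. \<Sum>l\<in>UNIV. (?c l i * (v i \<bullet> x)) *\<^sub>R v l)"
      by (simp only: sum.distrib[symmetric] scaleR_add_left[symmetric] distrib_right[symmetric] coeff)
    also have "\<dots> = (\<Sum>i\<in>UNIV. (v i \<bullet> x) *\<^sub>R (\<Sum>l\<in>UNIV. ?c l i *\<^sub>R v l))"
      unfolding scaleR_sum_right scaleR_scaleR by (simp only: mult_ac)
    also have "\<dots> = (\<Sum>i\<in>UNIV. (v i \<bullet> x) *\<^sub>R (S *v v i))"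
      by (intro sum.cong refl arg_cong[where f = "scaleR _"] orthonormal_expansion[OF v, symmetric])
    also have "\<dots> = S *v (\<Sum>i\<in>UNIV. (v i \<bullet> x) *\<^sub>R v i)"
      unfolding linear_sum[OF matrix_vector_mul_linear] matrix_vector_mult_scaleR ..
    also have "\<dots> = S *v x"
      by (intro arg_cong[where f = "(*v) S"] orthonormal_expansion[OF v, symmetric])
    finally show ?thesis .
  qed
  then show ?thesis by (intro matrix_eq[THEN iffD2] allI) (rule sym)
qed

section \<open>Expansion of the Hessian at a strict saddle\<close>

theorem lemma3p3:
  fixes f :: "real^'n \<Rightarrow> real"
    and xs :: "real^'n"
    and L M \<beta> \<delta> :: real
    and lam :: "'n \<Rightarrow> real"
    and v :: "'n \<Rightarrow> real^'n"
  assumes "C2 f"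
    and "\<And>s. strict_saddle f s \<Longrightarrow> \<exists>U. open U \<and> s \<in> U \<and> real_analytic_on f U"
    and "\<And>x y. norm (grad f x - grad f y) \<le> L * norm (x - y)"
    and "\<And>x y. spectral_norm (hess f x - hess f y) \<le> M * norm (x - y)"
    and "\<beta> > 0"
    and "\<And>x \<mu>. critical_point f x \<Longrightarrow> eigenval (hess f x) \<mu> \<Longrightarrow> \<bar>\<mu>\<bar> > \<beta>"
    and "strict_saddle f xs"
    and "\<And>i. eigenpair (hess f xs) (lam i) (v i)"
    and "\<And>i l. v i \<bullet> v l = (if i = l then 1 else 0)"
    and "\<delta> > 0"
    and "\<And>i l. i \<noteq> l \<Longrightarrow> \<bar>lam i - lam l\<bar> \<ge> \<delta>"
  defines "r \<equiv> (\<lambda>j u. spectral_norm (hess_dderiv f xs j u))"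
    and "H \<equiv> (\<lambda>u. vector_derivative (\<lambda>w::real. hess f (xs + w *\<^sub>R u)) (at 0))"
  shows "\<exists>C. \<forall>\<epsilon>>0.
    ereal \<epsilon> < (INF u\<in>{u. norm u = 1}. inverse (limsup (\<lambda>j. ereal (root j (r j u / fact j))))) \<longrightarrow>
    (\<forall>x u p. x \<in> ball xs \<epsilon> \<and> u \<noteq> 0 \<and> norm u \<le> \<epsilon> \<and> 0 < p \<and> p \<le> 1 \<and> x = xs + p *\<^sub>R u \<longrightarrow>
      (let h = u /\<^sub>R norm u in
        norm (hess f x - (hess f xs + (p * norm u) *\<^sub>R H h)) \<le> C * \<epsilon>\<^sup>2 \<and>
        H h = (\<Sum>i\<in>UNIV.
            (v i \<bullet> (H h *v v i)) *\<^sub>R outer (v i) (v i)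
          + lam i *\<^sub>R outer (\<Sum>l\<in>UNIV - {i}. ((v l \<bullet> (H h *v v i)) / (lam i - lam l)) *\<^sub>R v l) (v i)
          + lam i *\<^sub>R outer (v i) (\<Sum>l\<in>UNIV - {i}. ((v l \<bullet> (H h *v v i)) / (lam i - lam l)) *\<^sub>R v l))))"
proof -
  have df: "\<And>x. f differentiable (at x)" and dg: "\<And>x. grad f differentiable (at x)"
    using assms(1) by (auto simp: C2_def)
  obtain U where U: "real_analytic_on f U" "xs \<in> U" using assms(2)[OF assms(7)] by blast
  obtain B K \<rho> where r: "0 < \<rho>" and B: "bounded_linear B" and sym: "\<And>z. transpose (B z) = B z"
    and near: "\<And>z. norm z \<le> \<rho> \<Longrightarrow> norm (hess f (xs + z) - hess f xs - B z) \<le> K * (norm z)\<^sup>2"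
    by (rule hess_expansion[OF df dg U]) blast
  have hess': "(hess f has_derivative B) (at xs)"
    by (rule has_derivative_quadratic_remainder[OF B r]) (rule near, simp)
  \<comment> \<open>The quadratic remainder makes \<open>B\<close> the derivative of the Hessian at
    \<open>xs\<close>; the chain rule along the line then identifies \<open>H\<close>.\<close>
  have H: "H u = B u" for u
  proof -
    have "((\<lambda>w::real. hess f (xs + w *\<^sub>R u)) has_derivative (\<lambda>w. B (w *\<^sub>R u))) (at 0)"
      by (rule has_derivative_compose[where g = "hess f" and f = "\<lambda>w::real. xs + w *\<^sub>R u"])
         (use hess' in \<open>auto intro!: derivative_eq_intros\<close>)
    then have "((\<lambda>w::real. hess f (xs + w *\<^sub>R u)) has_vector_derivative B u) (at 0)"
      by (simp add: has_vector_derivative_def linear_scale[OF bounded_linear.linear[OF B]])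
    then show ?thesis unfolding H_def by (rule vector_derivative_at)
  qed
  obtain b where b: "\<And>z. norm (B z) \<le> norm z * b" using bounded_linear.bounded[OF B] by blast
  \<comment> \<open>The first summand bounds the Hessian difference, the second bounds
    \<open>B\<close>. Absolute values are taken because the signs of \<open>M\<close> and
    \<open>b\<close> are not known.\<close>
  define D where "D = \<bar>(real CARD('n))\<^sup>2 * M\<bar> + \<bar>b\<bar>"
  have far: "norm (hess f (xs + z) - hess f xs - B z) \<le> D * norm z" for z
  proof -
    have "norm (hess f (xs + z) - hess f xs) \<le> (real CARD('n))\<^sup>2 * (M * norm z)"
      using assms(4)[of "xs + z" xs]
      by (intro order_trans[OF norm_matrix_le_spectral_norm] mult_left_mono) auto
    also have "\<dots> \<le> \<bar>(real CARD('n))\<^sup>2 * M\<bar> * norm z"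
      by (simp add: mult.assoc[symmetric] mult_right_mono)
    finally have 1: "norm (hess f (xs + z) - hess f xs) \<le> \<bar>(real CARD('n))\<^sup>2 * M\<bar> * norm z" .
    have "norm (B z) \<le> \<bar>b\<bar> * norm z"
      by (rule order_trans[OF b]) (simp add: mult.commute mult_right_mono)
    with 1 show ?thesis
      using norm_triangle_ineq4[of "hess f (xs + z) - hess f xs" "B z"]
      by (simp add: D_def distrib_right)
  qed
  \<comment> \<open>Taking \<open>\<bar>K\<bar>\<close> in the maximum also makes \<open>C\<close>
    nonnegative, which the final passage from \<open>norm (p *\<^sub>R u)\<close> to
    \<open>\<epsilon>\<close> requires.\<close>
  define C where "C = max \<bar>K\<bar> (D / \<rho>)"
  have remainder: "norm (hess f (xs + z) - hess f xs - B z) \<le> C * (norm z)\<^sup>2" for z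
  proof (cases "norm z \<le> \<rho>")
    case True
    have "K * (norm z)\<^sup>2 \<le> C * (norm z)\<^sup>2" by (intro mult_right_mono) (auto simp: C_def)
    then show ?thesis using near[OF True] by linarith
  next
    case False
    have "D * norm z = D / \<rho> * (\<rho> * norm z)" using r by simp
    also have "\<dots> \<le> D / \<rho> * (norm z)\<^sup>2"
      using False r by (intro mult_left_mono) (auto simp: D_def power2_eq_square mult_right_mono)
    also have "\<dots> \<le> C * (norm z)\<^sup>2" by (intro mult_right_mono) (auto simp: C_def)
    finally show ?thesis using far[of z] by linarith
  qed
  have lam: "inj lam" using assms(10,11) by (force intro: injI)
  have expansion: "norm (hess f x - (hess f xs + (p * norm u) *\<^sub>R H (u /\<^sub>R norm u))) \<le> C * \<epsilon>\<^sup>2"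
    if "u \<noteq> 0" "norm u \<le> \<epsilon>" "0 < p" "p \<le> 1" "x = xs + p *\<^sub>R u" for x u p \<epsilon>
  proof -
    \<comment> \<open>By linearity the normalisation of \<open>u\<close> cancels, so the first-order
      term is \<open>B\<close> at the actual displacement \<open>p *\<^sub>R u\<close>.\<close>
    have "(p * norm u) *\<^sub>R H (u /\<^sub>R norm u) = B ((p * norm u) *\<^sub>R (u /\<^sub>R norm u))"
      by (simp add: H linear_scale[OF bounded_linear.linear[OF B]])
    also have "(p * norm u) *\<^sub>R (u /\<^sub>R norm u) = p *\<^sub>R u" using that by simp
    finally have "norm (hess f x - (hess f xs + (p * norm u) *\<^sub>R H (u /\<^sub>R norm u)))
        \<le> C * (norm (p *\<^sub>R u))\<^sup>2"
      using remainder[of "p *\<^sub>R u"] that by (simp add: algebra_simps)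
    also have "norm (p *\<^sub>R u) \<le> \<epsilon>"
      using that mult_mono[of p 1 "norm u" \<epsilon>] by simp
    then have "C * (norm (p *\<^sub>R u))\<^sup>2 \<le> C * \<epsilon>\<^sup>2"
      by (intro mult_left_mono power_mono) (auto simp: C_def)
    finally show ?thesis .
  qed
  have "transpose (H u) = H u" for u by (simp add: H sym)
  then have perturbation: "H u = (\<Sum>i\<in>UNIV.
            (v i \<bullet> (H u *v v i)) *\<^sub>R outer (v i) (v i)
          + lam i *\<^sub>R outer (\<Sum>l\<in>UNIV - {i}. ((v l \<bullet> (H u *v v i)) / (lam i - lam l)) *\<^sub>R v l) (v i)
          + lam i *\<^sub>R outer (v i) (\<Sum>l\<in>UNIV - {i}. ((v l \<bullet> (H u *v v i)) / (lam i - lam l)) *\<^sub>R v l))"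
    for u
    by (rule symmetric_eq_eigenvector_perturbation[OF _ assms(9) lam])
  show ?thesis
    unfolding Let_def
  proof (rule exI[of _ C], intro allI impI, elim conjE, rule conjI)
    fix \<epsilon> p :: real and x u :: "real^'n"
    assume "u \<noteq> 0" "norm u \<le> \<epsilon>" "0 < p" "p \<le> 1" "x = xs + p *\<^sub>R u"
    then show "norm (hess f x - (hess f xs + (p * norm u) *\<^sub>R H (u /\<^sub>R norm u))) \<le> C * \<epsilon>\<^sup>2"
      by (rule expansion)
  qed (rule perturbation)
qed

end
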